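(* The fractional linear map $Z\mapsto i(\tilde e_3Z+1)(\tilde e_3Z-1)^{-1}$ on $\mathbb H_{\mathbb C}$ maps $\mathbb M$ into $U(1,1)$ (away from its singularities) and sends the unit one-sheeted hyperboloid $\tilde H=\{Y\in\mathbb M: N(Y)=1\}$ into $SU(1,1)=\{X\in\mathbb H_{\mathbb R}: N(X)=1\}$ (away from its singularities). The singularities of this map on $\mathbb M$ lie along $\{Y\in\mathbb M: N(Y)=1,\ \operatorname{Re}(e_3Y)=0\}$. Conversely, the fractional linear map $Z\mapsto \tilde e_3(Z+i)(Z-i)^{-1}$ on $\mathbb H_{\mathbb C}$ maps $U(1,1)$ into $\mathbb M$ (away from its singularities) and sends $SU(1,1)$ into $\tilde H$ (away from its singularities). The singularities of this map on $\mathbb H_{\mathbb R}$ lie along the two-sheeted hyperboloid $\{X\in SU(1,1): \operatorname{Re}X=0\}$.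
   Context: $\mathbb H_{\mathbb C}$ is the algebra of complex $2\times2$ matrices $Z=\begin{pmatrix} z_{11}&z_{12}\\ z_{21}&z_{22}\end{pmatrix}$; $N(Z)=\det Z$ and $\operatorname{Re}Z=\frac12\operatorname{Tr}Z=\frac12(z_{11}+z_{22})$. Scalars denote scalar matrices. Real subspaces: $\mathbb H_{\mathbb R}=\{Z: z_{22}=\overline{z_{11}},\ z_{21}=\overline{z_{12}}\}$ (split quaternions) and $\mathbb M=\{Z: z_{11},z_{22}\in i\mathbb R,\ z_{21}=-\overline{z_{12}}\}$ (Minkowski space). Put $e_3=\begin{pmatrix}-i&0\\0&i\end{pmatrix}$ and $\tilde e_3=ie_3=\begin{pmatrix}1&0\\0&-1\end{pmatrix}$. $U(1,1)=\{Z\in\mathbb H_{\mathbb C}: Z^*\tilde e_3Z=\tilde e_3\}$, with $Z^*$ the conjugate transpose. The singularities of a fractional linear map are the points where the matrix to be inverted in its formula is not invertible. *)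

theory Defs
  imports "HOL-Analysis.Analysis"
begin

type_synonym biquat = "complex ^ 2 ^ 2"

abbreviation qnorm :: "biquat \<Rightarrow> complex" where
  "qnorm Z \<equiv> det Z"

definition qRe :: "biquat \<Rightarrow> complex" where
  "qRe Z = trace Z / 2"

definition ctranspose :: "biquat \<Rightarrow> biquat" where
  "ctranspose Z = (\<chi> i j. cnj (Z $ j $ i))"

definition split_quat :: "biquat set" where
  "split_quat = {Z. Z $ 2 $ 2 = cnj (Z $ 1 $ 1) \<and> Z $ 2 $ 1 = cnj (Z $ 1 $ 2)}"

definition minkowski :: "biquat set" where
  "minkowski = {Z. Re (Z $ 1 $ 1) = 0 \<and> Re (Z $ 2 $ 2) = 0 \<and> Z $ 2 $ 1 = - cnj (Z $ 1 $ 2)}"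

definition e3 :: biquat where
  "e3 = vector [vector [- \<i>, 0], vector [0, \<i>]]"

definition te3 :: biquat where
  "te3 = vector [vector [1, 0], vector [0, - 1]]"

lemma te3_eq: "te3 = mat \<i> ** e3"
  by (simp add: te3_def e3_def vec_eq_iff forall_2 matrix_matrix_mult_def sum_2 mat_def)

definition U11 :: "biquat set" where
  "U11 = {Z. ctranspose Z ** te3 ** Z = te3}"

definition SU11 :: "biquat set" where
  "SU11 = {X \<in> split_quat. qnorm X = 1}"

definition hyperboloid1 :: "biquat set" where
  "hyperboloid1 = {Y \<in> minkowski. qnorm Y = 1}"

text \<open>
  A complex scalar \<open>c\<close> stands for the scalar matrix \<open>mat c\<close>. The two maps below are written as
  total functions; their values are meaningful only off the sets \<open>cayley_M_sing\<close> and
  \<open>cayley_U_sing\<close>, where the matrix to be inverted is not invertible.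
\<close>

definition cayley_M :: "biquat \<Rightarrow> biquat" where
  "cayley_M Z = mat \<i> ** (te3 ** Z + mat 1) ** matrix_inv (te3 ** Z - mat 1)"

definition cayley_M_sing :: "biquat set" where
  "cayley_M_sing = {Z. \<not> invertible (te3 ** Z - mat 1)}"

definition cayley_U :: "biquat \<Rightarrow> biquat" where
  "cayley_U Z = te3 ** (Z + mat \<i>) ** matrix_inv (Z - mat \<i>)"

definition cayley_U_sing :: "biquat set" where
  "cayley_U_sing = {Z. \<not> invertible (Z - mat \<i>)}"

end

theory Submission
  imports Defs
begin

text \<open>
  Write \<open>J\<close> for \<open>te3\<close> and \<open>c\<close> for the scalar matrix \<open>mat c\<close>. Both maps are quotients
  \<open>A ** matrix_inv B\<close> of matrices that are affine in the variable, and membership of such a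
  quotient in \<open>U11\<close> or in \<open>minkowski\<close> amounts to an equation in which no inverse occurs: it lies
  in \<open>U11\<close> when \<open>A\<close> and \<open>B\<close> pull the form \<open>J\<close> back to the same form (\<open>quotient_in_U11\<close>), and
  it is skew-Hermitian when \<open>ctranspose B ** A\<close> is (\<open>quotient_in_minkowski\<close>). The space
  \<open>minkowski\<close> consists of the skew-Hermitian matrices. As \<open>J\<close> is a Hermitian involution, it
  follows for \<open>Y\<close> in \<open>minkowski\<close> that \<open>W = J ** Y\<close> is skew for the form \<open>J\<close>; then the cross
  terms in the pullbacks of \<open>J\<close> by \<open>W + 1\<close> and \<open>W - 1\<close> vanish. If instead \<open>X\<close> preserves \<open>J\<close>,
  then the constant and quadratic terms of \<open>ctranspose (X - \<i>) ** J ** (X + \<i>)\<close> cancel, and a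
  skew-Hermitian matrix remains.

  The norm-one statements and the singular sets follow from the characteristic polynomial
  \<open>det (Z + c) = det Z + c * trace Z + c\<^sup>2\<close>. At a regular point of norm \<open>1\<close>,
  the numerator and the denominator of each map have the same nonzero determinant, so the image
  has norm \<open>1\<close>; and \<open>SU11\<close> is the part of \<open>U11\<close> of norm \<open>1\<close> (\<open>SU11_eq\<close>). On \<open>minkowski\<close>
  and on \<open>split_quat\<close>, the determinant of the denominator is the sum of a real number, given by
  the norm, and an imaginary one, given by the trace, so it vanishes only if both do.
\<close>

lemmas entrywise = vec_eq_iff forall_2 matrix_matrix_mult_def sum_2 mat_def

lemma ctranspose_mult: "ctranspose (A ** B) = ctranspose B ** ctranspose A"
  by (simp add: ctranspose_def entrywise mult.commute)

lemma ctranspose_mat: "ctranspose (mat c) = mat (cnj c)"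
  by (simp add: ctranspose_def entrywise)

lemma ctranspose_te3: "ctranspose te3 = te3"
  by (simp add: ctranspose_def te3_def entrywise)

lemma te3_te3: "te3 ** te3 = mat 1"
  by (simp add: te3_def entrywise)

lemma det_te3: "det te3 = -1"
  by (simp add: te3_def det_2)

lemma trace_2: "trace (Z :: biquat) = Z $ 1 $ 1 + Z $ 2 $ 2"
  by (simp add: trace_def sum_2)

lemma det_add_mat: "det (Z + mat c :: biquat) = det Z + c * trace Z + c\<^sup>2"
  by (simp add: det_2 trace_2 mat_def algebra_simps power2_eq_square)

lemma det_diff_mat: "det (Z - mat c :: biquat) = det Z - c * trace Z + c\<^sup>2"
  by (simp add: det_2 trace_2 mat_def algebra_simps power2_eq_square)

lemma det_mat_2: "det (mat c :: biquat) = c\<^sup>2"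
  by (simp add: det_2 mat_def power2_eq_square)

lemma invertible_inverse:
  assumes "invertible B"
  shows "B ** matrix_inv B = mat 1" and "matrix_inv B ** B = mat 1"
proof -
  have "B ** matrix_inv B = mat 1 \<and> matrix_inv B ** B = mat 1"
    using assms unfolding invertible_def matrix_inv_def by (rule someI_ex)
  then show "B ** matrix_inv B = mat 1" and "matrix_inv B ** B = mat 1" by auto
qed

lemma det_quotient:
  fixes A B :: biquat
  assumes "invertible B"
  shows "det (A ** matrix_inv B) = det A / det B"
proof -
  have "det (A ** matrix_inv B) * det B = det (A ** (matrix_inv B ** B))"
    by (simp add: det_mul)
  also have "\<dots> = det A"
    by (simp add: invertible_inverse [OF assms])
  finally show ?thesis
    using assms by (simp add: invertible_det_nz field_simps)
qed

lemma minkowski_iff_skew: "Y \<in> minkowski \<longleftrightarrow> ctranspose Y = - Y"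
  by (auto simp: minkowski_def ctranspose_def vec_eq_iff forall_2 complex_eq_iff)

text \<open>
  If \<open>det X = 1\<close>, then the inverse of \<open>X\<close> is its adjugate, and cancelling \<open>X\<close> in the equation of
  \<open>U11\<close> leaves \<open>ctranspose X ** te3\<close> equal to \<open>te3\<close> times the adjugate; entry by entry, these are
  the linear equations of \<open>split_quat\<close>.
\<close>
lemma SU11_eq: "SU11 = {X \<in> U11. qnorm X = 1}"
proof -
  have "X \<in> split_quat \<longleftrightarrow> X \<in> U11" if d: "qnorm X = 1" for X
  proof -
    define K :: biquat where
      "K = vector [vector [X $ 2 $ 2, - X $ 1 $ 2], vector [- X $ 2 $ 1, X $ 1 $ 1]]"
    have XK: "X ** K = mat 1" and KX: "K ** X = mat 1"
      using d by (auto simp: K_def entrywise det_2 algebra_simps)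
    have "X \<in> U11 \<longleftrightarrow> ctranspose X ** te3 = te3 ** K"
      unfolding U11_def mem_Collect_eq
      by (metis XK KX matrix_mul_assoc matrix_mul_rid)
    also have "\<dots> \<longleftrightarrow> X \<in> split_quat"
      by (auto simp: K_def ctranspose_def te3_def split_quat_def entrywise)
    finally show ?thesis by simp
  qed
  then show ?thesis by (auto simp: SU11_def)
qed

text \<open>
  The equation says that \<open>A\<close> and \<open>B\<close> pull \<open>te3\<close> back to the same form. Pulling this form back
  further by the inverse of \<open>B\<close> turns the right-hand side into \<open>te3\<close>.
\<close>
lemma quotient_in_U11:
  assumes B: "invertible B"
    and eq: "ctranspose A ** te3 ** A = ctranspose B ** te3 ** B"
  shows "A ** matrix_inv B \<in> U11"
proof -
  let ?C = "matrix_inv B"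
  have "ctranspose (A ** ?C) ** te3 ** (A ** ?C)
      = ctranspose ?C ** (ctranspose A ** te3 ** A) ** ?C"
    by (simp add: ctranspose_mult matrix_mul_assoc)
  also have "\<dots> = ctranspose (B ** ?C) ** te3 ** (B ** ?C)"
    by (simp add: eq ctranspose_mult matrix_mul_assoc)
  also have "\<dots> = te3"
    by (simp add: invertible_inverse [OF B] ctranspose_mat)
  finally show ?thesis by (simp add: U11_def)
qed

text \<open>
  Being skew-Hermitian is invariant under the congruence \<open>M \<mapsto> ctranspose B ** M ** B\<close>, which
  turns the quotient into \<open>ctranspose B ** A\<close>, where no inverse occurs.
\<close>
lemma quotient_in_minkowski:
  assumes B: "invertible B"
    and eq: "ctranspose A ** B = - (ctranspose B ** A)"
  shows "A ** matrix_inv B \<in> minkowski"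
proof -
  let ?C = "matrix_inv B"
  have neg: "M ** (- P) ** Q = - (M ** P ** Q)" for M P Q :: biquat
    by (simp add: entrywise algebra_simps)
  have "ctranspose (A ** ?C) = ctranspose ?C ** (ctranspose A ** B) ** ?C"
    by (simp add: ctranspose_mult invertible_inverse [OF B] flip: matrix_mul_assoc)
  also have "\<dots> = - (ctranspose (B ** ?C) ** (A ** ?C))"
    by (simp add: eq neg ctranspose_mult matrix_mul_assoc)
  also have "\<dots> = - (A ** ?C)"
    by (simp add: invertible_inverse [OF B] ctranspose_mat)
  finally show ?thesis by (simp add: minkowski_iff_skew)
qed

lemma cayley_M_in_U11:
  assumes Y: "Y \<in> minkowski" and inv: "invertible (te3 ** Y - mat 1)"
  shows "cayley_M Y \<in> U11"
proof -
  define W where "W = te3 ** Y"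
  \<comment> \<open>\<open>W\<close> lies in the Lie algebra of \<open>U11\<close>: this map is a Cayley transform of the group.\<close>
  have skew: "ctranspose W ** te3 = - (te3 ** W)"
  proof -
    have "ctranspose W ** te3 = ctranspose Y ** (te3 ** te3)"
      by (simp add: W_def ctranspose_mult ctranspose_te3 flip: matrix_mul_assoc)
    also have "\<dots> = - (te3 ** te3 ** Y)"
      using Y by (simp add: te3_te3 minkowski_iff_skew)
    finally show ?thesis by (simp add: W_def matrix_mul_assoc)
  qed
  have "ctranspose (mat \<i> ** (W + mat 1)) ** te3 ** (mat \<i> ** (W + mat 1))
      = ctranspose (W + mat 1) ** te3 ** (W + mat 1)"
    by (simp add: ctranspose_def entrywise algebra_simps)
  also have "\<dots> = ctranspose (W - mat 1) ** te3 ** (W - mat 1)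
      + 2 *\<^sub>R (ctranspose W ** te3 + te3 ** W)"
    by (simp add: ctranspose_def entrywise algebra_simps scaleR_2)
  also have "\<dots> = ctranspose (W - mat 1) ** te3 ** (W - mat 1)"
    by (simp add: skew)
  finally show ?thesis
    unfolding cayley_M_def W_def [symmetric] using inv
    by (intro quotient_in_U11) (simp_all add: W_def)
qed

text \<open>
  If \<open>Y\<close> has norm \<open>1\<close>, then \<open>W = te3 ** Y\<close> has determinant \<open>-1\<close>, and the constant terms cancel
  in \<open>det (W + 1) = trace W\<close> and \<open>det (W - 1) = - trace W\<close>. The scalar factor
  \<open>\<i>\<close> contributes \<open>\<i>\<^sup>2 = -1\<close> to the determinant and corrects the sign.
\<close>
lemma qnorm_cayley_M:
  assumes "qnorm Y = 1" and inv: "invertible (te3 ** Y - mat 1)"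
  shows "qnorm (cayley_M Y) = 1"
proof -
  have W: "det (te3 ** Y) = -1"
    using assms by (simp add: det_mul det_te3)
  then have "trace (te3 ** Y) \<noteq> 0"
    using inv by (simp add: invertible_det_nz det_diff_mat)
  then show ?thesis
    using W
    by (simp add: cayley_M_def det_quotient [OF inv] det_mul [of "mat \<i>"] det_mat_2
        det_add_mat det_diff_mat)
qed

lemma cayley_M_singularities:
  "minkowski \<inter> cayley_M_sing = {Y \<in> minkowski. qnorm Y = 1 \<and> qRe (e3 ** Y) = 0}"
proof -
  have "Y \<in> cayley_M_sing \<longleftrightarrow> qnorm Y = 1 \<and> qRe (e3 ** Y) = 0" if Y: "Y \<in> minkowski" for Y
  proof -
    have tr: "trace (te3 ** Y) = 2 * \<i> * qRe (e3 ** Y)"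
      by (simp add: qRe_def trace_2 te3_def e3_def entrywise algebra_simps)
    have "Im (qnorm Y) = 0" "Im (qRe (e3 ** Y)) = 0"
      using Y by (auto simp: minkowski_def qRe_def trace_2 e3_def entrywise det_2)
    moreover have "det (te3 ** Y - mat 1) = 1 - qnorm Y - 2 * \<i> * qRe (e3 ** Y)"
      by (simp add: det_diff_mat tr det_mul det_te3)
    ultimately show ?thesis
      by (auto simp: cayley_M_sing_def invertible_det_nz complex_eq_iff)
  qed
  then show ?thesis by auto
qed

text \<open>
  With \<open>A = te3 ** (X + \<i>)\<close> and \<open>B = X - \<i>\<close>, the two products to be compared have the same part
  \<open>ctranspose X ** te3 ** X - te3\<close> and opposite linear parts, so they are negatives of each other
  because the common part vanishes on \<open>U11\<close>.
\<close>
lemma cayley_U_in_minkowski: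
  assumes X: "X \<in> U11" and inv: "invertible (X - mat \<i>)"
  shows "cayley_U X \<in> minkowski"
proof -
  let ?S = "mat \<i> ** (ctranspose X ** te3 + te3 ** X)"
  have P: "ctranspose X ** te3 ** X = te3"
    using X by (simp add: U11_def)
  have "ctranspose (te3 ** (X + mat \<i>)) ** (X - mat \<i>)
      = ctranspose X ** te3 ** X - te3 - ?S"
    by (simp add: te3_def ctranspose_def entrywise algebra_simps)
  moreover have "ctranspose (X - mat \<i>) ** (te3 ** (X + mat \<i>))
      = ctranspose X ** te3 ** X - te3 + ?S"
    by (simp add: te3_def ctranspose_def entrywise algebra_simps)
  ultimately show ?thesis
    unfolding cayley_U_def using inv
    by (intro quotient_in_minkowski) (simp_all add: P)
qed

text \<open>
  If \<open>det X = 1\<close>, then \<open>det (X + \<i>) = \<i> * trace X\<close> and \<open>det (X - \<i>) = - \<i> * trace X\<close>, because \<open>\<i>\<^sup>2\<close> cancels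
  \<open>det X\<close>; the factor \<open>te3\<close> corrects the sign.
\<close>
lemma qnorm_cayley_U:
  assumes "qnorm X = 1" and inv: "invertible (X - mat \<i>)"
  shows "qnorm (cayley_U X) = 1"
proof -
  have "trace X \<noteq> 0"
    using assms by (simp add: invertible_det_nz det_diff_mat)
  then show ?thesis
    using assms(1)
    by (simp add: cayley_U_def det_quotient [OF inv] det_mul [of te3] det_te3
        det_add_mat det_diff_mat)
qed

lemma cayley_U_singularities: "split_quat \<inter> cayley_U_sing = {X \<in> SU11. qRe X = 0}"
proof -
  have "X \<in> cayley_U_sing \<longleftrightarrow> qnorm X = 1 \<and> qRe X = 0" if X: "X \<in> split_quat" for X
  proof -
    have "Im (qnorm X) = 0" "Im (qRe X) = 0"
      using X by (auto simp: split_quat_def qRe_def trace_2 det_2)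
    moreover have "det (X - mat \<i>) = qnorm X - 1 - 2 * \<i> * qRe X"
      by (simp add: det_diff_mat qRe_def)
    ultimately show ?thesis
      by (auto simp: cayley_U_sing_def invertible_det_nz complex_eq_iff)
  qed
  then show ?thesis by (auto simp: SU11_def)
qed

theorem proposition58:
  "cayley_M ` (minkowski - cayley_M_sing) \<subseteq> U11 \<and>
   cayley_M ` (hyperboloid1 - cayley_M_sing) \<subseteq> SU11 \<and>
   minkowski \<inter> cayley_M_sing = {Y \<in> minkowski. qnorm Y = 1 \<and> qRe (e3 ** Y) = 0} \<and>
   cayley_U ` (U11 - cayley_U_sing) \<subseteq> minkowski \<and>
   cayley_U ` (SU11 - cayley_U_sing) \<subseteq> hyperboloid1 \<and>
   split_quat \<inter> cayley_U_sing = {X \<in> SU11. qRe X = 0}"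
  by (intro conjI cayley_M_singularities cayley_U_singularities)
    (auto simp: SU11_eq hyperboloid1_def cayley_M_sing_def cayley_U_sing_def
      intro: cayley_M_in_U11 qnorm_cayley_M cayley_U_in_minkowski qnorm_cayley_U)

end
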